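(* Fix $\delta,\alpha_0\in(0,1)$ and an integer $B\ge1$. Let $\mathbf{Y}=(\mathbf{Y}^1,\dots,\mathbf{Y}^n)$ be a sample of i.i.d. integrable random vectors in $\mathbb{R}^K$ with mean $\mu$, whose distribution is symmetric about $\mu$: $(\mathbf{Y}^i-\mu)\sim(\mu-\mathbf{Y}^i)$. Let $\mathbf{W}$ be an $n\times B$ matrix of i.i.d. Rademacher weights, independent of $\mathbf{Y}$. Let $f$ be a nonnegative function of $(\mathbf{Y},\mathbf{W})$, let $\phi:\mathbb{R}^K\to\mathbb{R}$ be a nonnegative, subadditive and positive homogeneous function, and let $\widetilde{\phi}(x):=\max(\phi(x),\phi(-x))$. Then $$\mathbb{P}_{\mathbf{Y},\mathbf{W}}\big(\phi(\overline{\mathbf{Y}}-\mu)>\widetilde{q}_{\alpha_0(1-\delta)}(\phi,\mathbf{Y}-\overline{\mathbf{Y}},\mathbf{W})+\gamma(\mathbf{W},\alpha_0\delta)f(\mathbf{Y},\mathbf{W})\big)\le\widetilde{\alpha}_0+\mathbb{P}_{\mathbf{Y},\mathbf{W}}\big(\widetilde{\phi}(\overline{\mathbf{Y}}-\mu)>f(\mathbf{Y},\mathbf{W})\big),$$ where $\widetilde{\alpha}_0:=\frac{\lfloor B\alpha_0\rfloor+1}{B+1}\le\alpha_0+\frac{1}{B+1}$ and $\gamma(\mathbf{W},\eta):=\max\big\{y\ge0\,\big|\,\frac1B\sum_{j=1}^B\mathbf{1}\{|\overline{\mathbf{W}}^j|\ge y\}\ge\eta\big\}$.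
   Context: $K\ge1$ and $n\ge2$ are integers. Rademacher weights take values $\pm1$ with probability $1/2$ each. $\mathbf{W}^j\in\{-1,1\}^n$ is the $j$th column of $\mathbf{W}$ and $\overline{\mathbf{W}}^j=\frac1n\sum_{i=1}^n\mathbf{W}^j_i$ its mean. $\overline{\mathbf{Y}}=\frac1n\sum_{i=1}^n\mathbf{Y}^i$; $\mathbf{Y}-\overline{\mathbf{Y}}$ denotes the $K\times n$ matrix with columns $\mathbf{Y}^i-\overline{\mathbf{Y}}$. For $w\in\mathbb{R}^n$ and a $K\times n$ matrix $\mathbf{X}$ with columns $\mathbf{X}^i$, $\overline{\mathbf{X}}^{\langle w\rangle}=\frac1n\sum_{i=1}^nw_i\mathbf{X}^i$. The Monte Carlo resampled quantile is $$\widetilde{q}_\alpha(\phi,\mathbf{X},\mathbf{W}):=\inf\Big\{x\in\mathbb{R}\,\Big|\,\frac1B\sum_{j=1}^B\mathbf{1}\{\phi(\overline{\mathbf{X}}^{\langle\mathbf{W}^j\rangle})\ge x\}\le\alpha\Big\}.$$ $\mathbb{P}_{\mathbf{Y},\mathbf{W}}$ is the joint probability over $(\mathbf{Y},\mathbf{W})$. Subadditive means $\phi(x+x')\le\phi(x)+\phi(x')$; positive homogeneous means $\phi(\lambda x)=\lambda\phi(x)$ for all $\lambda\in\mathbb{R}^+$. *)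

theory Defs
  imports "HOL-Probability.Probability"
begin

(* A p \<times> q matrix has type real^'q^'p, with p = CARD('p), q = CARD('q) and columns  column i X . *)

definition vec_mean :: "real^'n \<Rightarrow> real" where
  "vec_mean w = (1 / real CARD('n)) * (\<Sum>i\<in>UNIV. w $ i)"

definition sample_mean :: "real^'n^'k \<Rightarrow> real^'k" where
  "sample_mean X = (1 / real CARD('n)) *\<^sub>R (\<Sum>i\<in>UNIV. column i X)"

definition centred :: "real^'n^'k \<Rightarrow> real^'n^'k" where
  "centred X = (\<chi> k i. (column i X - sample_mean X) $ k)"

definition resampled_mean :: "real^'n^'k \<Rightarrow> real^'n \<Rightarrow> real^'k" where
  "resampled_mean X w = (1 / real CARD('n)) *\<^sub>R (\<Sum>i\<in>UNIV. w $ i *\<^sub>R column i X)"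

definition mc_quantile ::
    "real \<Rightarrow> (real^'k \<Rightarrow> real) \<Rightarrow> real^'n^'k \<Rightarrow> real^'b^'n \<Rightarrow> real" where
  "mc_quantile \<alpha> \<phi> X W =
     Inf {x::real. (1 / real CARD('b)) *
            (\<Sum>j\<in>UNIV. of_bool (\<phi> (resampled_mean X (column j W)) \<ge> x)) \<le> \<alpha>}"

(* The maximum of an infinite set of reals, hence GREATEST rather than Max. It is attained for
   0 < \<eta> \<le> 1: the set contains 0, and it is closed and bounded above. *)
definition mc_gamma :: "real^'b^'n \<Rightarrow> real \<Rightarrow> real" where
  "mc_gamma W \<eta> =
     (GREATEST y::real. 0 \<le> y \<and>
        (1 / real CARD('b)) * (\<Sum>j\<in>UNIV. of_bool (\<bar>vec_mean (column j W)\<bar> \<ge> y)) \<ge> \<eta>)"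

definition subadditive_fun :: "('v::real_vector \<Rightarrow> real) \<Rightarrow> bool" where
  "subadditive_fun \<phi> \<longleftrightarrow> (\<forall>x x'. \<phi> (x + x') \<le> \<phi> x + \<phi> x')"

(* Including c = 0 would change nothing: \<phi> 0 = 2 * \<phi> 0 already gives \<phi> 0 = 0. *)
definition pos_homogeneous :: "('v::real_vector \<Rightarrow> real) \<Rightarrow> bool" where
  "pos_homogeneous \<phi> \<longleftrightarrow> (\<forall>x. \<forall>c>0. \<phi> (c *\<^sub>R x) = c * \<phi> x)"

definition sym_max :: "('v::real_vector \<Rightarrow> real) \<Rightarrow> 'v \<Rightarrow> real" where
  "sym_max \<phi> x = max (\<phi> x) (\<phi> (- x))"

definition rademacher :: "'a measure \<Rightarrow> ('a \<Rightarrow> real) \<Rightarrow> bool" where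
  "rademacher M X \<longleftrightarrow> X \<in> borel_measurable M \<and>
     measure M {\<omega> \<in> space M. X \<omega> = 1} = 1 / 2 \<and>
     measure M {\<omega> \<in> space M. X \<omega> = - 1} = 1 / 2"

(* prob_space.indep_var requires both variables to have the same type; this is its
   characterisation indep_var_eq for variables of different types. *)
definition indep_rv :: "'a measure \<Rightarrow> 'c measure \<Rightarrow> ('a \<Rightarrow> 'c) \<Rightarrow> 'd measure \<Rightarrow> ('a \<Rightarrow> 'd) \<Rightarrow> bool" where
  "indep_rv M S X T Z \<longleftrightarrow> X \<in> measurable M S \<and> Z \<in> measurable M T \<and>
     prob_space.indep_set M
       (sigma_sets (space M) {X -` A \<inter> space M | A. A \<in> sets S})
       (sigma_sets (space M) {Z -` A \<inter> space M | A. A \<in> sets T})"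

definition alpha_tilde :: "nat \<Rightarrow> real \<Rightarrow> real" where
  "alpha_tilde B \<alpha> = (of_int \<lfloor>real B * \<alpha>\<rfloor> + 1) / (real B + 1)"

end

theory Submission
  imports Defs
begin

text \<open>Put \<open>Z\<^sub>i = Y\<^sub>i - \<mu>\<close> and, for a sign vector \<open>s\<close>, let \<open>T s = \<phi> (1/n \<Sum> s\<^sub>i Z\<^sub>i)\<close>; the statistic of
interest is \<open>T 1\<close>, for the constant vector \<open>1\<close>. Two ideas combine.

The first is a permutation test with the uncentred data. Since the \<open>Z\<^sub>i\<close> are independent and
symmetric, multiplying them by a fixed sign vector \<open>s\<close> does not change their law. It replaces
\<open>T 1, T w\<^sub>1, \<dots>, T w\<^sub>B\<close> by \<open>T s, T (s w\<^sub>1), \<dots>, T (s w\<^sub>B)\<close>, and as \<open>(w\<^sub>1, \<dots>, w\<^sub>B)\<close>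
runs over all sign matrices, so does \<open>(s w\<^sub>1, \<dots>, s w\<^sub>B)\<close>. Averaging over \<open>s\<close> as well, \<open>T 1\<close>
behaves like one of \<open>B + 1\<close> exchangeable values, so the probability that at most \<open>k\<close> of the other
\<open>B\<close> values reach it is at most \<open>(k + 1) / (B + 1)\<close>. Ties are harmless, because they count against
the event. This is \<open>prob_few_resampled_exceedances_le\<close>; it rests on the counting lemma
\<open>card_few_exceedances_le\<close> and the invariance \<open>distr_flip_signs\<close>.

The second is a deterministic comparison with the centred data, \<open>card_resampled_exceedances_le\<close>.
Centring by the empirical mean changes the resampled mean for \<open>w\<close> by the average of \<open>w\<close> times
\<open>Zbar\<close>, the mean of the \<open>Z\<^sub>i\<close>, so by sublinearity \<open>T w\<close> exceeds its centred version by at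
most \<open>\<bar>wbar\<bar>\<close> times the symmetrised \<open>\<phi>\<close> of \<open>Zbar\<close>. Unless the latter exceeds \<open>f\<close>, an
index \<open>j\<close> with \<open>T w\<^sub>j \<ge> T 1 > q + \<gamma> f\<close> must have its centred statistic above the quantile \<open>q\<close>,
or \<open>\<bar>wbar\<^sub>j\<bar>\<close> above \<open>\<gamma>\<close>. At most \<open>B \<alpha>\<^sub>0 (1 - \<delta>)\<close> indices do the former and at most
\<open>B \<alpha>\<^sub>0 \<delta>\<close> the latter, which makes at most \<open>\<lfloor>B \<alpha>\<^sub>0\<rfloor>\<close> in all: the first idea applies
with \<open>k = \<lfloor>B \<alpha>\<^sub>0\<rfloor>\<close>.\<close>

section \<open>Ranks among exchangeable values\<close>

text \<open>Among the members of the set on the left, take one with the smallest value: its rank counts all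
the others.\<close>

lemma card_low_rank_le:
  fixes T :: "'i::finite \<Rightarrow> real"
  shows "card {i. card {j. j \<noteq> i \<and> T i \<le> T j} \<le> k} \<le> Suc k"
proof (cases "{i. card {j. j \<noteq> i \<and> T i \<le> T j} \<le> k} = {}")
  case False
  let ?R = "{i. card {j. j \<noteq> i \<and> T i \<le> T j} \<le> k}"
  have "finite ?R" by simp
  then obtain i where i: "i \<in> ?R" and min: "\<And>j. j \<in> ?R \<Longrightarrow> T i \<le> T j"
    using False ex_min_if_finite[of "T ` ?R"]
    by (metis (no_types, lifting) arg_min_least arg_min_if_finite(1))
  have "?R - {i} \<subseteq> {j. j \<noteq> i \<and> T i \<le> T j}"
    using min by auto
  then have "card (?R - {i}) \<le> card {j. j \<noteq> i \<and> T i \<le> T j}"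
    by (intro card_mono) auto
  also have "\<dots> \<le> k" using i by simp
  finally show ?thesis
    using i by (simp add: card_Diff_singleton)
qed simp

text \<open>Transposing two coordinates permutes the tuples, so every coordinate is of low rank equally
often, while in a single tuple at most \<open>Suc k\<close> coordinates are.\<close>

lemma card_low_rank_coordinate_le:
  fixes t :: "'s \<Rightarrow> real" and i\<^sub>0 :: "'i::finite"
  assumes "finite S"
  shows "CARD('i) * card {v \<in> UNIV \<rightarrow>\<^sub>E S. card {j. j \<noteq> i\<^sub>0 \<and> t (v i\<^sub>0) \<le> t (v j)} \<le> k}
    \<le> Suc k * card S ^ CARD('i)"
proof -
  let ?V = "(UNIV :: 'i set) \<rightarrow>\<^sub>E S"
  let ?low = "\<lambda>v i. card {j. j \<noteq> i \<and> t (v i) \<le> t (v j)} \<le> k"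
  have fin: "finite ?V" using assms by (intro finite_PiE) auto
  have same: "card {v \<in> ?V. ?low v i} = card {v \<in> ?V. ?low v i\<^sub>0}" for i
  proof (rule bij_betw_same_card)
    let ?\<tau> = "Transposition.transpose i i\<^sub>0"
    \<comment> \<open>transposing the tuple carries the rank of its coordinate \<open>a\<close> to the transposed coordinate\<close>
    have low: "?low (v \<circ> ?\<tau>) (?\<tau> a) \<longleftrightarrow> ?low v a" for v a
    proof -
      have "{j. j \<noteq> ?\<tau> a \<and> t ((v \<circ> ?\<tau>) (?\<tau> a)) \<le> t ((v \<circ> ?\<tau>) j)}
          = ?\<tau> ` {j. j \<noteq> a \<and> t (v a) \<le> t (v j)}"
        by (auto simp: image_iff) (metis transpose_involutory)+
      then show ?thesis
        by (simp add: card_image inj_on_subset[OF inj_transpose])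
    qed
    show "bij_betw (\<lambda>v. v \<circ> ?\<tau>) {v \<in> ?V. ?low v i} {v \<in> ?V. ?low v i\<^sub>0}"
    proof (rule bij_betwI[where g = "\<lambda>v. v \<circ> ?\<tau>"])
      show "(\<lambda>v. v \<circ> ?\<tau>) \<in> {v \<in> ?V. ?low v i} \<rightarrow> {v \<in> ?V. ?low v i\<^sub>0}"
        using low[of i] by (auto simp: PiE_iff)
      show "(\<lambda>v. v \<circ> ?\<tau>) \<in> {v \<in> ?V. ?low v i\<^sub>0} \<rightarrow> {v \<in> ?V. ?low v i}"
        using low[of i\<^sub>0] by (auto simp: PiE_iff)
    qed (simp_all add: comp_assoc)
  qed
  have "CARD('i) * card {v \<in> ?V. ?low v i\<^sub>0} = (\<Sum>i\<in>(UNIV :: 'i set). card {v \<in> ?V. ?low v i\<^sub>0})"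
    by (simp only: sum_constant of_nat_id)
  also have "\<dots> = (\<Sum>i\<in>UNIV. card {v \<in> ?V. ?low v i})"
    by (rule sum.cong[OF refl same[symmetric]])
  also have "\<dots> = (\<Sum>v\<in>?V. card {i. ?low v i})"
    using sum.swap_restrict[OF finite[of "UNIV :: 'i set"] fin, of "\<lambda>_ _. 1 :: nat" "\<lambda>i v. ?low v i"] by simp
  also have "\<dots> \<le> (\<Sum>v\<in>?V. Suc k)"
    by (intro sum_mono card_low_rank_le)
  also have "\<dots> = Suc k * card S ^ CARD('i)"
    by (simp add: card_PiE)
  finally show ?thesis .
qed

text \<open>The rank bound in the form used for a test: the observed value \<open>s\<close> plays the part of the
coordinate \<open>None\<close> of a tuple indexed by \<open>'b option\<close>.\<close>

lemma card_few_exceedances_le: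
  fixes t :: "'s \<Rightarrow> real"
  assumes "finite S"
  shows "(CARD('b::finite) + 1) *
      card {(s, w :: 'b \<Rightarrow> 's). s \<in> S \<and> w \<in> UNIV \<rightarrow>\<^sub>E S \<and> card {j. t s \<le> t (w j)} \<le> k}
    \<le> Suc k * card S ^ (CARD('b) + 1)"
proof -
  let ?A = "{(s, w :: 'b \<Rightarrow> 's). s \<in> S \<and> w \<in> UNIV \<rightarrow>\<^sub>E S \<and> card {j. t s \<le> t (w j)} \<le> k}"
  let ?B = "{v \<in> (UNIV :: 'b option set) \<rightarrow>\<^sub>E S. card {j. j \<noteq> None \<and> t (v None) \<le> t (v j)} \<le> k}"
  have low: "card {j. j \<noteq> None \<and> t (v None) \<le> t (v j)} = card {j. t (v None) \<le> t (v (Some j))}"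
    for v :: "'b option \<Rightarrow> 's"
  proof -
    have "{j. j \<noteq> None \<and> t (v None) \<le> t (v j)} = Some ` {j. t (v None) \<le> t (v (Some j))}"
      by (auto simp: image_iff)
    then show ?thesis by (simp add: card_image)
  qed
  have B: "?B = {v \<in> UNIV \<rightarrow>\<^sub>E S. card {j. t (v None) \<le> t (v (Some j))} \<le> k}"
    by (simp only: low)
  have "bij_betw (\<lambda>(s, w). case_option s w) ?A ?B"
    unfolding B
  proof (rule bij_betwI[where g = "\<lambda>v. (v None, \<lambda>j. v (Some j))"])
    show "(\<lambda>(s, w). case_option s w) \<in> ?A \<rightarrow> {v \<in> UNIV \<rightarrow>\<^sub>E S. card {j. t (v None) \<le> t (v (Some j))} \<le> k}"
      by (auto simp: PiE_iff split: option.split)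
    show "(\<lambda>v. (v None, \<lambda>j. v (Some j))) \<in> {v \<in> UNIV \<rightarrow>\<^sub>E S. card {j. t (v None) \<le> t (v (Some j))} \<le> k} \<rightarrow> ?A"
      by (auto simp: PiE_iff)
    show "(\<lambda>(s, w). case_option s w) ((\<lambda>v. (v None, \<lambda>j. v (Some j))) v) = v" for v :: "'b option \<Rightarrow> 's"
      by (auto split: option.split)
  qed auto
  then have "card ?A = card ?B" by (rule bij_betw_same_card)
  then show ?thesis
    using card_low_rank_coordinate_le[OF assms, where t = t and k = k and i\<^sub>0 = "None :: 'b option"]
    by (simp add: card_UNIV_option)
qed

section \<open>Signed means of symmetric vectors\<close>

definition weighted_mean :: "('n::finite \<Rightarrow> 'v::real_vector) \<Rightarrow> ('n \<Rightarrow> real) \<Rightarrow> 'v" where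
  "weighted_mean z s = (1 / real CARD('n)) *\<^sub>R (\<Sum>i\<in>UNIV. s i *\<^sub>R z i)"

abbreviation sign_vectors :: "('n \<Rightarrow> real) set" where
  "sign_vectors \<equiv> UNIV \<rightarrow>\<^sub>E {- 1, 1}"

lemma card_sign_vectors: "card (sign_vectors :: ('n::finite \<Rightarrow> real) set) = 2 ^ CARD('n)"
  by (simp add: card_PiE numeral_2_eq_2)

lemma finite_sign_vectors: "finite (sign_vectors :: ('n::finite \<Rightarrow> real) set)"
  by (intro finite_PiE) auto

lemma sign_vector_mult_self: "s \<in> sign_vectors \<Longrightarrow> s i * s i = 1"
  by (auto simp: PiE_iff) (metis mult_1 mult_minus1 minus_minus)

text \<open>By independence the joint law is the product of the marginal laws, and each marginal law is
invariant under a change of sign.\<close>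

lemma (in prob_space) distr_flip_signs:
  fixes Z :: "'n::finite \<Rightarrow> 'a \<Rightarrow> 'v::euclidean_space"
  assumes ind: "indep_vars (\<lambda>_. borel) Z UNIV"
    and sym: "\<And>i. distr M borel (Z i) = distr M borel (\<lambda>\<omega>. - Z i \<omega>)"
    and s: "s \<in> sign_vectors"
  shows "distr M (\<Pi>\<^sub>M i\<in>UNIV. borel) (\<lambda>\<omega> i. s i *\<^sub>R Z i \<omega>)
    = distr M (\<Pi>\<^sub>M i\<in>UNIV. borel) (\<lambda>\<omega> i. Z i \<omega>)"
proof -
  have rv[measurable]: "Z i \<in> borel_measurable M" for i
    using ind by (auto simp: indep_vars_def)
  have ind': "indep_vars (\<lambda>_. borel) (\<lambda>i \<omega>. s i *\<^sub>R Z i \<omega>) UNIV"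
    by (rule indep_vars_compose2[OF ind]) simp
  have "distr M borel (\<lambda>\<omega>. s i *\<^sub>R Z i \<omega>) = distr M borel (Z i)" for i
  proof -
    have "s i = 1 \<or> s i = - 1" using s by (auto simp: PiE_iff)
    then show ?thesis using sym[of i] by auto
  qed
  then show ?thesis
    using indep_vars_iff_distr_eq_PiM[where I = UNIV and M' = "\<lambda>_. borel" and X = Z] ind
      indep_vars_iff_distr_eq_PiM[where I = UNIV and M' = "\<lambda>_. borel"
        and X = "\<lambda>i \<omega>. s i *\<^sub>R Z i \<omega>"] ind'
    by (simp add: restrict_UNIV)
qed

text \<open>The sum runs over the sign matrices with columns \<open>w j\<close>; dividing by their number turns the left side
into the probability of the event for a uniform sign matrix independent of \<open>Z\<close>. Each summand is
unchanged when \<open>Z\<close> is replaced by \<open>s Z\<close>, and \<open>w \<mapsto> s w\<close> permutes the sign matrices, so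
the observed vector \<open>1\<close> may be replaced by any \<open>s\<close>. Summing over \<open>s\<close> too gives, for each fixed
value of \<open>Z\<close>, the counting problem of \<open>card_few_exceedances_le\<close>.\<close>

lemma (in prob_space) sum_prob_few_exceedances_le:
  fixes Z :: "'n::finite \<Rightarrow> 'a \<Rightarrow> 'v::euclidean_space" and \<phi> :: "'v \<Rightarrow> real"
  assumes ind: "indep_vars (\<lambda>_. borel) Z UNIV"
    and sym: "\<And>i. distr M borel (Z i) = distr M borel (\<lambda>\<omega>. - Z i \<omega>)"
    and phi[measurable]: "\<phi> \<in> borel_measurable borel"
  shows "(\<Sum>w \<in> (UNIV :: 'b::finite set) \<rightarrow>\<^sub>E sign_vectors.
      prob {\<omega> \<in> space M. card {j. \<phi> (weighted_mean (\<lambda>i. Z i \<omega>) (\<lambda>_. 1))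
                              \<le> \<phi> (weighted_mean (\<lambda>i. Z i \<omega>) (w j))} \<le> k})
    \<le> (real k + 1) / (real CARD('b) + 1) * 2 ^ (CARD('n) * CARD('b))"
proof -
  let ?S = "sign_vectors :: ('n \<Rightarrow> real) set"
  let ?SM = "(UNIV :: 'b set) \<rightarrow>\<^sub>E ?S"
  let ?N = "(\<Pi>\<^sub>M i\<in>(UNIV::'n set). borel) :: ('n \<Rightarrow> 'v) measure"
  define low where "low s w z \<longleftrightarrow>
      card {j. \<phi> (weighted_mean z s) \<le> \<phi> (weighted_mean z (w j))} \<le> k"
    for s and w :: "'b \<Rightarrow> 'n \<Rightarrow> real" and z :: "'n \<Rightarrow> 'v"
  define p where "p s w = prob {\<omega> \<in> space M. low s w (\<lambda>i. Z i \<omega>)}" for s w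
  have rv[measurable]: "Z i \<in> borel_measurable M" for i
    using ind by (auto simp: indep_vars_def)
  have finS: "finite ?S" and finSM: "finite ?SM"
    by (auto intro!: finite_PiE)
  have wm[measurable]: "(\<lambda>z. weighted_mean z s) \<in> borel_measurable ?N" for s
    unfolding weighted_mean_def by measurable
  have low_meas[measurable]: "Measurable.pred ?N (low s w)" for s w
  proof -
    have "real (card {j. \<phi> (weighted_mean z s) \<le> \<phi> (weighted_mean z (w j))})
        = (\<Sum>j\<in>UNIV. if \<phi> (weighted_mean z s) \<le> \<phi> (weighted_mean z (w j)) then 1 else 0)" for z
      by (simp add: sum.If_cases)
    then have "low s w = (\<lambda>z. (\<Sum>j\<in>UNIV. if \<phi> (weighted_mean z s) \<le> \<phi> (weighted_mean z (w j))
        then 1 else 0) \<le> real k)"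
      unfolding low_def fun_eq_iff by (metis of_nat_le_iff)
    then show ?thesis by simp
  qed
  have Zm[measurable]: "(\<lambda>\<omega> i. Z i \<omega>) \<in> measurable M ?N"
    by (rule measurable_PiM_single') (auto simp: space_PiM)
  have flip: "p (\<lambda>_. 1) w = p s (\<lambda>j i. s i * w j i)" if s: "s \<in> ?S" for s w
  proof -
    let ?A = "{z \<in> space ?N. low (\<lambda>_. 1) w z}"
    have sZm[measurable]: "(\<lambda>\<omega> i. s i *\<^sub>R Z i \<omega>) \<in> measurable M ?N"
      by (rule measurable_PiM_single') (auto simp: space_PiM)
    have A: "?A \<in> sets ?N" by measurable
    have "p (\<lambda>_. 1) w = measure (distr M ?N (\<lambda>\<omega> i. Z i \<omega>)) ?A"
      unfolding p_def by (subst measure_distr[OF Zm A]) (auto intro!: arg_cong[where f = prob] simp: space_PiM)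
    also have "\<dots> = measure (distr M ?N (\<lambda>\<omega> i. s i *\<^sub>R Z i \<omega>)) ?A"
      by (simp add: distr_flip_signs[OF ind sym s])
    also have "\<dots> = prob {\<omega> \<in> space M. low (\<lambda>_. 1) w (\<lambda>i. s i *\<^sub>R Z i \<omega>)}"
      by (subst measure_distr[OF sZm A]) (auto intro!: arg_cong[where f = prob] simp: space_PiM)
    also have "\<dots> = p s (\<lambda>j i. s i * w j i)"
      by (simp add: p_def low_def weighted_mean_def mult.commute)
    finally show ?thesis .
  qed
  have orbit: "(\<Sum>w\<in>?SM. p (\<lambda>_. 1) w) = (\<Sum>w\<in>?SM. p s w)" if s: "s \<in> ?S" for s
  proof -
    let ?m = "\<lambda>(w :: 'b \<Rightarrow> 'n \<Rightarrow> real) j i. s i * w j i"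
    have s2: "s i * (s i * x) = x" for i x
      using sign_vector_mult_self[OF s, of i] by (simp flip: mult.assoc)
    have "s i = 1 \<or> s i = - 1" for i using s by (auto simp: PiE_iff)
    then have m: "?m w \<in> ?SM" if "w \<in> ?SM" for w
      using that by (simp add: PiE_iff) (metis minus_minus mult_1 mult_minus1)
    \<comment> \<open>multiplication by a sign vector is an involution\<close>
    have "bij_betw ?m ?SM ?SM"
      by (rule bij_betwI[where g = ?m]) (use m in \<open>auto simp: s2 simp del: PiE_UNIV_domain\<close>)
    then have "(\<Sum>w\<in>?SM. p s (?m w)) = (\<Sum>w\<in>?SM. p s w)"
      by (rule sum.reindex_bij_betw)
    then show ?thesis by (simp add: flip[OF s])
  qed
  have count: "(\<Sum>s\<in>?S. \<Sum>w\<in>?SM. of_bool (low s w z))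
      \<le> (real k + 1) / (real CARD('b) + 1) * 2 ^ (CARD('n) * (CARD('b) + 1))" for z
  proof -
    let ?C = "{(s, w). s \<in> ?S \<and> w \<in> ?SM \<and> low s w z}"
    have "(\<Sum>s\<in>?S. \<Sum>w\<in>?SM. of_bool (low s w z)) = (\<Sum>(s, w)\<in>?S \<times> ?SM. of_bool (low s w z) :: real)"
      by (rule sum.cartesian_product)
    also have "\<dots> = (\<Sum>x\<in>?S \<times> ?SM. of_bool (low (fst x) (snd x) z))"
      by (simp add: case_prod_beta)
    also have "\<dots> = real (card (?S \<times> ?SM \<inter> {x. low (fst x) (snd x) z}))"
      using finS finSM by (subst sum_of_bool_eq) (auto intro: finite_cartesian_product)
    also have "?S \<times> ?SM \<inter> {x. low (fst x) (snd x) z} = ?C" by auto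
    finally have sum: "(\<Sum>s\<in>?S. \<Sum>w\<in>?SM. of_bool (low s w z)) = real (card ?C)" .
    have "(CARD('b) + 1) * card ?C \<le> Suc k * card ?S ^ (CARD('b) + 1)"
      using card_few_exceedances_le[OF finS, where t = "\<lambda>s. \<phi> (weighted_mean z s)" and k = k and 'b = 'b]
      by (simp add: low_def)
    then have "real ((CARD('b) + 1) * card ?C) \<le> real (Suc k * card ?S ^ (CARD('b) + 1))"
      by (rule of_nat_mono)
    then have "(real CARD('b) + 1) * real (card ?C) \<le> (real k + 1) * 2 ^ (CARD('n) * (CARD('b) + 1))"
      unfolding card_sign_vectors power_mult[symmetric] by (simp add: algebra_simps)
    then show ?thesis unfolding sum by (simp add: field_simps)
  qed
  have meas: "{\<omega> \<in> space M. low s w (\<lambda>i. Z i \<omega>)} \<in> events" for s w by measurable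
  have int: "integrable M (\<lambda>\<omega>. of_bool (low s w (\<lambda>i. Z i \<omega>)) :: real)" for s w
    by (rule integrable_const_bound[where B = 1]) auto
  have p_int: "p s w = (\<integral>\<omega>. of_bool (low s w (\<lambda>i. Z i \<omega>)) \<partial>M)" for s w
  proof -
    have "p s w = (\<integral>\<omega>. indicator {\<omega> \<in> space M. low s w (\<lambda>i. Z i \<omega>)} \<omega> \<partial>M)"
      using meas by (simp add: p_def)
    also have "\<dots> = (\<integral>\<omega>. of_bool (low s w (\<lambda>i. Z i \<omega>)) \<partial>M)"
      by (rule Bochner_Integration.integral_cong) (auto simp: indicator_def)
    finally show ?thesis .
  qed
  have "2 ^ CARD('n) * (\<Sum>w\<in>?SM. p (\<lambda>_. 1) w) = (\<Sum>s\<in>?S. \<Sum>w\<in>?SM. p (\<lambda>_. 1) w)"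
    by (simp only: sum_constant card_sign_vectors of_nat_power of_nat_numeral)
  also have "\<dots> = (\<Sum>s\<in>?S. \<Sum>w\<in>?SM. p s w)"
    by (rule sum.cong[OF refl orbit])
  also have "\<dots> = (\<integral>\<omega>. (\<Sum>s\<in>?S. \<Sum>w\<in>?SM. of_bool (low s w (\<lambda>i. Z i \<omega>))) \<partial>M)"
    by (simp add: p_int int)
  also have "\<dots> \<le> (\<integral>\<omega>. (real k + 1) / (real CARD('b) + 1) * 2 ^ (CARD('n) * (CARD('b) + 1)) \<partial>M)"
    by (intro integral_mono count Bochner_Integration.integrable_sum int integrable_const)
  also have "\<dots> = 2 ^ CARD('n) * ((real k + 1) / (real CARD('b) + 1) * 2 ^ (CARD('n) * CARD('b)))"
    by (simp add: prob_space power_add)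
  finally have "(\<Sum>w\<in>?SM. p (\<lambda>_. 1) w)
      \<le> (real k + 1) / (real CARD('b) + 1) * 2 ^ (CARD('n) * CARD('b))"
    by (rule mult_left_le_imp_le) simp
  then show ?thesis unfolding p_def low_def .
qed

section \<open>Rademacher matrices\<close>

lemma (in prob_space) prob_sign_matrix:
  fixes W :: "'a \<Rightarrow> real^'b^'n"
  assumes ind: "indep_vars (\<lambda>_. borel) (\<lambda>(i, j) \<omega>. W \<omega> $ i $ j) UNIV"
    and rad: "\<And>i j. rademacher M (\<lambda>\<omega>. W \<omega> $ i $ j)"
    and w: "\<And>i j. w j i \<in> {- 1, 1}"
  shows "prob {\<omega> \<in> space M. \<forall>i j. W \<omega> $ i $ j = w j i} = 1 / 2 ^ (CARD('n) * CARD('b))"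
proof -
  let ?X = "\<lambda>(i, j) \<omega>. W \<omega> $ i $ j"
  have "{\<omega> \<in> space M. \<forall>i j. W \<omega> $ i $ j = w j i}
      = (\<Inter>p\<in>UNIV. ?X p -` {w (snd p) (fst p)} \<inter> space M)"
    by auto
  then have "prob {\<omega> \<in> space M. \<forall>i j. W \<omega> $ i $ j = w j i}
      = (\<Prod>p\<in>UNIV. prob (?X p -` {w (snd p) (fst p)} \<inter> space M))"
    using indep_varsD[OF ind, of UNIV "\<lambda>p. {w (snd p) (fst p)}"] by simp
  also have "\<dots> = (\<Prod>p\<in>(UNIV :: ('n \<times> 'b) set). 1 / 2)"
  proof (rule prod.cong[OF refl])
    fix p :: "'n \<times> 'b"
    have "?X p -` {w (snd p) (fst p)} \<inter> space M = {\<omega> \<in> space M. W \<omega> $ fst p $ snd p = w (snd p) (fst p)}"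
      by (auto simp: case_prod_beta)
    then show "prob (?X p -` {w (snd p) (fst p)} \<inter> space M) = 1 / 2"
      using rad[of "fst p" "snd p"] w[of "snd p" "fst p"] by (auto simp: rademacher_def)
  qed
  also have "\<dots> = 1 / 2 ^ (CARD('n) * CARD('b))"
    by (simp add: power_one_over)
  finally show ?thesis .
qed

lemma (in prob_space) AE_sign_matrix:
  fixes W :: "'a \<Rightarrow> real^'b^'n"
  assumes rad: "\<And>i j. rademacher M (\<lambda>\<omega>. W \<omega> $ i $ j)"
  shows "AE \<omega> in M. \<forall>i j. W \<omega> $ i $ j \<in> {- 1, 1}"
proof -
  have "AE \<omega> in M. W \<omega> $ i $ j \<in> {- 1, 1}" for i j
  proof -
    let ?X = "\<lambda>\<omega>. W \<omega> $ i $ j"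
    have [measurable]: "?X \<in> borel_measurable M"
      using rad by (simp add: rademacher_def)
    have "prob {\<omega> \<in> space M. ?X \<omega> \<in> {- 1, 1}} = prob ({\<omega> \<in> space M. ?X \<omega> = - 1} \<union> {\<omega> \<in> space M. ?X \<omega> = 1})"
      by (rule arg_cong[where f = prob]) auto
    also have "\<dots> = prob {\<omega> \<in> space M. ?X \<omega> = - 1} + prob {\<omega> \<in> space M. ?X \<omega> = 1}"
      by (rule finite_measure_Union) auto
    also have "\<dots> = 1" using rad[of i j] by (simp add: rademacher_def)
    finally have "prob {\<omega> \<in> space M. ?X \<omega> \<in> {- 1, 1}} = 1" .
    then show ?thesis by (subst (asm) prob_Collect_eq_1) auto
  qed
  then have "AE \<omega> in M. \<forall>i\<in>UNIV. \<forall>j\<in>UNIV. W \<omega> $ i $ j \<in> {- 1, 1}"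
    by (intro AE_finite_allI) auto
  then show ?thesis by simp
qed

section \<open>Empirical quantiles and tail levels\<close>

lemma mean_of_bool_conv_card:
  "(1 / real CARD('b)) * (\<Sum>j\<in>UNIV. of_bool (P j)) = real (card {j :: 'b::finite. P j}) / real CARD('b)"
  by simp

text \<open>The infimum need not be attained, but finitely many values lie above it, and a level between the
infimum and the least of them that belongs to the set has the same exceedances.\<close>

lemma card_above_empirical_quantile_le:
  fixes T :: "'b::finite \<Rightarrow> real"
  assumes "0 \<le> \<alpha>"
  defines "q \<equiv> Inf {x. (1 / real CARD('b)) * (\<Sum>j\<in>UNIV. of_bool (T j \<ge> x)) \<le> \<alpha>}"
  shows "real (card {j. q < T j}) \<le> \<alpha> * real CARD('b)"
proof -
  let ?S = "{x. (1 / real CARD('b)) * (\<Sum>j\<in>UNIV. of_bool (T j \<ge> x)) \<le> \<alpha>}"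
  have S: "x \<in> ?S \<longleftrightarrow> real (card {j. x \<le> T j}) \<le> \<alpha> * real CARD('b)" for x
    by (simp only: mem_Collect_eq mean_of_bool_conv_card) (simp add: divide_le_eq)
  have ne: "?S \<noteq> {}"
  proof -
    have "{j. Max (range T) + 1 \<le> T j} = {}"
    proof -
      have "T j < Max (range T) + 1" for j
        by (rule le_less_trans[of _ "Max (range T)"]) simp_all
      then show ?thesis by (auto simp: not_le)
    qed
    then have "Max (range T) + 1 \<in> ?S" using assms(1) by (simp only: S) simp
    then show ?thesis by blast
  qed
  show ?thesis
  proof (cases "{j. q < T j} = {}")
    case True
    then show ?thesis using assms(1) by simp
  next
    case False
    define m where "m = Min (T ` {j. q < T j})"
    have m: "m \<in> T ` {j. q < T j}"
      unfolding m_def using False by (intro Min_in) auto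
    then have "q < m" by auto
    then have "Inf ?S < m" by (simp only: q_def)
    from cInf_lessD[OF ne this] obtain x where x: "x \<in> ?S" "x < m" by blast
    have "{j. q < T j} \<subseteq> {j. x \<le> T j}"
    proof
      fix j assume "j \<in> {j. q < T j}"
      then have "m \<le> T j" unfolding m_def by (intro Min_le) auto
      then show "j \<in> {j. x \<le> T j}" using x(2) by simp
    qed
    then have "card {j. q < T j} \<le> card {j. x \<le> T j}" by (intro card_mono) auto
    also have "real \<dots> \<le> \<alpha> * real CARD('b)" using x(1) by (simp only: S)
    finally show ?thesis by simp
  qed
qed

text \<open>Raising a level to the least value of \<open>a\<close> at or above it leaves the values counted the same.
Hence the greatest admissible level exists and is a value of \<open>a\<close>; and if a proportion of at least
\<open>\<eta>\<close> of the values lay strictly above it, the least of these would be a greater admissible level.\<close>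

lemma greatest_tail_level:
  fixes a :: "'b::finite \<Rightarrow> real"
  assumes nonneg: "\<And>j. 0 \<le> a j" and "0 < \<eta>" "\<eta> \<le> 1"
  defines "g \<equiv> (GREATEST y::real. 0 \<le> y \<and> (1 / real CARD('b)) * (\<Sum>j\<in>UNIV. of_bool (a j \<ge> y)) \<ge> \<eta>)"
  shows "0 \<le> g" and "real (card {j. g < a j}) < \<eta> * real CARD('b)"
proof -
  define P where "P y \<longleftrightarrow> 0 \<le> y \<and> \<eta> * real CARD('b) \<le> real (card {j. y \<le> a j})" for y
  have g_eq: "g = (GREATEST y. P y)"
    unfolding g_def P_def mean_of_bool_conv_card by (simp add: le_divide_eq)
  \<comment> \<open>\<open>Q\<close> stands for either kind of exceedance, weak or strict\<close>
  have round_up: "\<exists>i. Q i \<and> P (a i)"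
    if Q: "\<And>i j. Q i \<Longrightarrow> a i \<le> a j \<Longrightarrow> Q j" and big: "\<eta> * real CARD('b) \<le> real (card {j. Q j})" for Q
  proof -
    have "{j. Q j} \<noteq> {}"
    proof
      assume "{j. Q j} = {}"
      with big have "\<eta> * real CARD('b) \<le> 0" by simp
      with \<open>0 < \<eta>\<close> show False by (simp add: mult_le_0_iff)
    qed
    then have "Min (a ` {j. Q j}) \<in> a ` {j. Q j}" by (intro Min_in) auto
    then obtain i where i: "Min (a ` {j. Q j}) = a i" "Q i" by blast
    have "a i \<le> a j" if "Q j" for j
      unfolding i(1)[symmetric] using that by (intro Min_le) auto
    then have "{j. Q j} = {j. a i \<le> a j}"
      using i(2) Q by blast
    with big i(2) nonneg[of i] show ?thesis by (auto simp: P_def)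
  qed
  have "\<exists>i. 0 \<le> a i \<and> P (a i)"
    using \<open>\<eta> \<le> 1\<close> nonneg by (intro round_up) (auto intro: order_trans)
  then obtain i\<^sub>0 where i\<^sub>0: "P (a i\<^sub>0)" by blast
  define c where "c = Max {c \<in> range a. P c}"
  have c: "c \<in> {c \<in> range a. P c}"
    unfolding c_def using i\<^sub>0 by (intro Max_in) auto
  have upper: "y \<le> c" if y: "P y" for y
  proof -
    have "\<exists>i. y \<le> a i \<and> P (a i)"
      using y by (intro round_up) (auto simp: P_def)
    then obtain i where i: "y \<le> a i" "P (a i)" by blast
    then have "a i \<le> c" unfolding c_def by (intro Max_ge) auto
    with i(1) show ?thesis by simp
  qed
  have g: "g = c"
    unfolding g_eq using c upper by (intro Greatest_equality) blast+
  show "0 \<le> g" using c by (simp add: g P_def)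
  show "real (card {j. g < a j}) < \<eta> * real CARD('b)"
  proof (rule ccontr)
    assume "\<not> ?thesis"
    then have "\<exists>i. g < a i \<and> P (a i)"
      by (intro round_up) auto
    with upper g show False by force
  qed
qed

section \<open>Centred and uncentred resampling\<close>

lemma sublinear_continuous:
  fixes \<phi> :: "'v::euclidean_space \<Rightarrow> real"
  assumes sub: "subadditive_fun \<phi>" and hom: "pos_homogeneous \<phi>"
  shows "continuous_on UNIV \<phi>"
proof (rule convex_on_continuous)
  show "convex_on UNIV \<phi>"
  proof (rule convex_onI)
    fix t :: real and x y :: 'v
    assume t: "0 < t" "t < 1"
    have "\<phi> ((1 - t) *\<^sub>R x + t *\<^sub>R y) \<le> \<phi> ((1 - t) *\<^sub>R x) + \<phi> (t *\<^sub>R y)"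
      using sub by (simp add: subadditive_fun_def)
    also have "\<dots> = (1 - t) * \<phi> x + t * \<phi> y"
      using hom t by (simp add: pos_homogeneous_def)
    finally show "\<phi> ((1 - t) *\<^sub>R x + t *\<^sub>R y) \<le> (1 - t) * \<phi> x + t * \<phi> y" .
  qed simp
qed simp

lemma sublinear_scale_le:
  assumes sub: "subadditive_fun \<phi>" and hom: "pos_homogeneous \<phi>"
  shows "\<phi> (c *\<^sub>R x) \<le> \<bar>c\<bar> * sym_max \<phi> x"
proof -
  have pos: "\<phi> (d *\<^sub>R y) = d * \<phi> y" if "0 < d" for d y
    using hom that by (simp add: pos_homogeneous_def)
  consider "c = 0" | "0 < c" | "c < 0" by linarith
  then show ?thesis
  proof cases
    case 1
    have "\<phi> 0 = 2 * \<phi> 0" using pos[of 2 0] by simp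
    with 1 show ?thesis by simp
  next
    case 2
    then show ?thesis by (simp add: pos sym_max_def)
  next
    case 3
    then have "\<phi> (c *\<^sub>R x) = \<phi> ((- c) *\<^sub>R (- x))" by simp
    also have "\<dots> = - c * \<phi> (- x)" using 3 by (intro pos) simp
    also have "\<dots> \<le> - c * sym_max \<phi> x"
      using 3 by (intro mult_left_mono) (auto simp: sym_max_def)
    finally show ?thesis using 3 by simp
  qed
qed

lemma sample_mean_minus_conv_weighted_mean:
  fixes y :: "real^'n^'k"
  shows "sample_mean y - \<mu> = weighted_mean (\<lambda>i. column i y - \<mu>) (\<lambda>_. 1)"
  by (simp add: sample_mean_def weighted_mean_def sum_subtractf scaleR_diff_right sum_constant_scaleR
      del: sum_constant)

lemma weighted_mean_eq_resampled_mean: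
  fixes y :: "real^'n^'k"
  shows "weighted_mean (\<lambda>i. column i y - \<mu>) (\<lambda>i. w $ i)
    = resampled_mean (centred y) w + vec_mean w *\<^sub>R (sample_mean y - \<mu>)"
proof -
  have col: "column i (centred y) = column i y - sample_mean y" for i
    by (simp add: centred_def column_def vec_eq_iff)
  have "w $ i *\<^sub>R (column i y - \<mu>)
      = w $ i *\<^sub>R column i (centred y) + w $ i *\<^sub>R (sample_mean y - \<mu>)" for i
    by (simp add: col algebra_simps)
  then have "(\<Sum>i\<in>UNIV. w $ i *\<^sub>R (column i y - \<mu>))
      = (\<Sum>i\<in>UNIV. w $ i *\<^sub>R column i (centred y)) + (\<Sum>i\<in>UNIV. w $ i) *\<^sub>R (sample_mean y - \<mu>)"
    by (simp only: sum.distrib scaleR_sum_left)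
  then show ?thesis
    by (simp add: weighted_mean_def resampled_mean_def vec_mean_def scaleR_add_right)
qed

text \<open>The deterministic half of the proof. The counts for the two ways in which an index can exceed, with
levels \<open>\<alpha> (1 - \<delta>)\<close> and \<open>\<alpha> \<delta>\<close>, add up to \<open>\<alpha>\<close>.\<close>

lemma card_resampled_exceedances_le:
  fixes y :: "real^'n^'k" and w :: "real^'b^'n"
  assumes \<delta>: "0 < \<delta>" "\<delta> < 1" and \<alpha>: "0 < \<alpha>" "\<alpha> < 1"
    and sub: "subadditive_fun \<phi>" and hom: "pos_homogeneous \<phi>"
    and r: "0 \<le> r" "sym_max \<phi> (sample_mean y - \<mu>) \<le> r"
    and exceed: "\<phi> (sample_mean y - \<mu>) >
      mc_quantile (\<alpha> * (1 - \<delta>)) \<phi> (centred y) w + mc_gamma w (\<alpha> * \<delta>) * r"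
  shows "card {j. \<phi> (sample_mean y - \<mu>)
      \<le> \<phi> (weighted_mean (\<lambda>i. column i y - \<mu>) (\<lambda>i. w $ i $ j))} \<le> nat \<lfloor>real CARD('b) * \<alpha>\<rfloor>"
proof -
  let ?q = "mc_quantile (\<alpha> * (1 - \<delta>)) \<phi> (centred y) w" and ?\<gamma> = "mc_gamma w (\<alpha> * \<delta>)"
  let ?R = "\<lambda>j. \<phi> (resampled_mean (centred y) (column j w))"
  let ?a = "\<lambda>j. \<bar>vec_mean (column j w)\<bar>"
  let ?T = "\<lambda>j. \<phi> (weighted_mean (\<lambda>i. column i y - \<mu>) (\<lambda>i. w $ i $ j))"
  have "\<alpha> * \<delta> \<le> 1"
    using \<delta> \<alpha> by (intro mult_le_one) auto
  then have q: "real (card {j. ?q < ?R j}) \<le> \<alpha> * (1 - \<delta>) * real CARD('b)"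
    and \<gamma>: "0 \<le> ?\<gamma>" "real (card {j. ?\<gamma> < ?a j}) < \<alpha> * \<delta> * real CARD('b)"
    unfolding mc_quantile_def mc_gamma_def using \<delta> \<alpha>
    by (intro card_above_empirical_quantile_le greatest_tail_level; simp)+
  have "{j. \<phi> (sample_mean y - \<mu>) \<le> ?T j} \<subseteq> {j. ?q < ?R j} \<union> {j. ?\<gamma> < ?a j}"
  proof
    fix j assume j: "j \<in> {j. \<phi> (sample_mean y - \<mu>) \<le> ?T j}"
    have "?T j = \<phi> (resampled_mean (centred y) (column j w)
        + vec_mean (column j w) *\<^sub>R (sample_mean y - \<mu>))"
      using weighted_mean_eq_resampled_mean[of y \<mu> "column j w"] by (simp add: column_def)
    also have "\<dots> \<le> ?R j + \<phi> (vec_mean (column j w) *\<^sub>R (sample_mean y - \<mu>))"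
      using sub by (simp add: subadditive_fun_def)
    also have "\<dots> \<le> ?R j + ?a j * sym_max \<phi> (sample_mean y - \<mu>)"
      using sublinear_scale_le[OF sub hom] by simp
    also have "\<dots> \<le> ?R j + ?a j * r"
      using r by (simp add: mult_left_mono)
    finally have "?q + ?\<gamma> * r < ?R j + ?a j * r"
      using j exceed by simp
    moreover have "?a j * r \<le> ?\<gamma> * r" if "?a j \<le> ?\<gamma>"
      using that r(1) by (rule mult_right_mono)
    ultimately show "j \<in> {j. ?q < ?R j} \<union> {j. ?\<gamma> < ?a j}"
      by (cases "?a j \<le> ?\<gamma>") auto
  qed
  then have "card {j. \<phi> (sample_mean y - \<mu>) \<le> ?T j} \<le> card ({j. ?q < ?R j} \<union> {j. ?\<gamma> < ?a j})"
    by (intro card_mono) auto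
  also have "\<dots> \<le> card {j. ?q < ?R j} + card {j. ?\<gamma> < ?a j}"
    by (rule card_Un_le)
  finally have "real (card {j. \<phi> (sample_mean y - \<mu>) \<le> ?T j})
      \<le> real (card {j. ?q < ?R j}) + real (card {j. ?\<gamma> < ?a j})"
    by (simp flip: of_nat_add)
  also have "\<dots> \<le> real CARD('b) * \<alpha>"
    using q \<gamma>(2) by (simp add: algebra_simps)
  finally show ?thesis
    by (simp add: le_nat_floor)
qed

text \<open>The probabilistic half of the proof: for \<open>\<mu>\<close> known, this bounds the level of the randomised sign-change test.
Conditioning on the value of \<open>W\<close>, which is uniform on the finite set of sign matrices, reduces it
to \<open>sum_prob_few_exceedances_le\<close>.\<close>

lemma (in prob_space) prob_few_resampled_exceedances_le:
  fixes Y :: "'a \<Rightarrow> real^'n^'k" and W :: "'a \<Rightarrow> real^'b^'n"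
    and \<mu> :: "real^'k" and \<phi> :: "real^'k \<Rightarrow> real" and k :: nat
  assumes Y_indep: "indep_vars (\<lambda>_. borel) (\<lambda>i \<omega>. column i (Y \<omega>)) UNIV"
    and Y_symmetric: "\<And>i. distr M borel (\<lambda>\<omega>. column i (Y \<omega>) - \<mu>) = distr M borel (\<lambda>\<omega>. \<mu> - column i (Y \<omega>))"
    and W_indep: "indep_vars (\<lambda>_. borel) (\<lambda>(i, j) \<omega>. W \<omega> $ i $ j) UNIV"
    and W_rademacher: "\<And>i j. rademacher M (\<lambda>\<omega>. W \<omega> $ i $ j)"
    and YW_indep: "indep_rv M borel Y borel W"
    and phi[measurable]: "\<phi> \<in> borel_measurable borel"
  defines "G \<equiv> {\<omega> \<in> space M. (\<forall>i j. W \<omega> $ i $ j \<in> {- 1, 1}) \<and>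
      card {j. \<phi> (sample_mean (Y \<omega>) - \<mu>)
        \<le> \<phi> (weighted_mean (\<lambda>i. column i (Y \<omega>) - \<mu>) (\<lambda>i. W \<omega> $ i $ j))} \<le> k}"
  shows "G \<in> events" and "prob G \<le> (real k + 1) / (real CARD('b) + 1)"
proof -
  let ?SM = "(UNIV :: 'b set) \<rightarrow>\<^sub>E (sign_vectors :: ('n \<Rightarrow> real) set)"
  let ?c = "2 ^ (CARD('n) * CARD('b)) :: real"
  define A where "A w = {y. card {j. \<phi> (weighted_mean (\<lambda>i. column i y - \<mu>) (\<lambda>_. 1))
      \<le> \<phi> (weighted_mean (\<lambda>i. column i y - \<mu>) (w j))} \<le> k}" for w :: "'b \<Rightarrow> 'n \<Rightarrow> real"
  define C where "C w = {x :: real^'b^'n. \<forall>i j. x $ i $ j = w j i}" for w :: "'b \<Rightarrow> 'n \<Rightarrow> real"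
  have finSM: "finite ?SM" by (intro finite_PiE finite_sign_vectors) simp
  have col[measurable]: "column i \<in> borel_measurable borel" for i :: 'n
    by (intro borel_measurable_continuous_onI) (auto simp: column_def intro!: continuous_intros)
  have A: "A w \<in> sets borel" for w
  proof -
    have [measurable]: "(\<lambda>y :: real^'n^'k. \<phi> (weighted_mean (\<lambda>i. column i y - \<mu>) s)) \<in> borel_measurable borel" for s
      unfolding weighted_mean_def by measurable
    have "real (card {j. \<phi> (weighted_mean (\<lambda>i. column i y - \<mu>) (\<lambda>_. 1))
          \<le> \<phi> (weighted_mean (\<lambda>i. column i y - \<mu>) (w j))})
        = (\<Sum>j\<in>UNIV. if \<phi> (weighted_mean (\<lambda>i. column i y - \<mu>) (\<lambda>_. 1))
          \<le> \<phi> (weighted_mean (\<lambda>i. column i y - \<mu>) (w j)) then 1 else 0)" for y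
      by (simp add: sum.If_cases)
    then have "A w = {y \<in> space borel. (\<Sum>j\<in>UNIV. if \<phi> (weighted_mean (\<lambda>i. column i y - \<mu>) (\<lambda>_. 1))
          \<le> \<phi> (weighted_mean (\<lambda>i. column i y - \<mu>) (w j)) then 1 else 0) \<le> real k}"
      unfolding A_def by (metis (no_types, lifting) of_nat_le_iff space_borel UNIV_I)
    then show ?thesis by simp
  qed
  have C: "C w \<in> sets borel" for w
  proof -
    have "C w = {(\<chi> i j. w j i)}" by (auto simp: C_def vec_eq_iff)
    then show ?thesis by simp
  qed
  have [measurable]: "Y \<in> borel_measurable M" "W \<in> borel_measurable M"
    using YW_indep by (auto simp: indep_rv_def)
  have ev[measurable]: "Y -` A w \<inter> space M \<in> events" "W -` C w \<inter> space M \<in> events" for w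
    using A C by (auto intro: measurable_sets)
  have G_eq: "G = (\<Union>w\<in>?SM. (Y -` A w \<inter> space M) \<inter> (W -` C w \<inter> space M))" (is "_ = ?U")
  proof
    show "G \<subseteq> ?U"
    proof
      fix \<omega> assume "\<omega> \<in> G"
      then have "(\<lambda>j i. W \<omega> $ i $ j) \<in> ?SM"
        "\<omega> \<in> (Y -` A (\<lambda>j i. W \<omega> $ i $ j) \<inter> space M) \<inter> (W -` C (\<lambda>j i. W \<omega> $ i $ j) \<inter> space M)"
        by (auto simp: G_def A_def C_def PiE_iff sample_mean_minus_conv_weighted_mean)
      then show "\<omega> \<in> ?U" by blast
    qed
    show "?U \<subseteq> G"
    proof
      fix \<omega> assume "\<omega> \<in> ?U"
      then obtain w where w: "w \<in> ?SM" "\<omega> \<in> space M" "Y \<omega> \<in> A w" "W \<omega> \<in> C w" by blast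
      then have "w = (\<lambda>j i. W \<omega> $ i $ j)" by (auto simp: C_def)
      with w show "\<omega> \<in> G"
        by (auto simp: G_def A_def PiE_iff sample_mean_minus_conv_weighted_mean)
    qed
  qed
  show "G \<in> events"
    unfolding G_eq by (intro sets.finite_UN[OF finSM] sets.Int[OF ev(1) ev(2)])
  have split: "prob ((Y -` A w \<inter> space M) \<inter> (W -` C w \<inter> space M)) = prob (Y -` A w \<inter> space M) / ?c"
    if w: "w \<in> ?SM" for w
  proof -
    have W_eq: "W -` C w \<inter> space M = {\<omega> \<in> space M. \<forall>i j. W \<omega> $ i $ j = w j i}"
      by (auto simp: C_def)
    have uniform: "prob (W -` C w \<inter> space M) = 1 / ?c"
      unfolding W_eq using w by (intro prob_sign_matrix[OF W_indep W_rademacher]) (auto simp: PiE_iff)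
    have "prob ((Y -` A w \<inter> space M) \<inter> (W -` C w \<inter> space M))
        = prob (Y -` A w \<inter> space M) * prob (W -` C w \<inter> space M)"
      using YW_indep A C unfolding indep_rv_def by (intro indep_setD) auto
    then show ?thesis by (simp add: uniform)
  qed
  have "prob G \<le> (\<Sum>w\<in>?SM. prob ((Y -` A w \<inter> space M) \<inter> (W -` C w \<inter> space M)))"
    unfolding G_eq using finSM ev by (intro finite_measure_subadditive_finite) auto
  also have "\<dots> = (\<Sum>w\<in>?SM. prob (Y -` A w \<inter> space M)) / ?c"
    by (simp only: sum_divide_distrib split cong: sum.cong)
  also have "\<dots> \<le> ((real k + 1) / (real CARD('b) + 1) * ?c) / ?c"
  proof (rule divide_right_mono)
    have ind: "indep_vars (\<lambda>_. borel) (\<lambda>i \<omega>. column i (Y \<omega>) - \<mu>) UNIV"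
      by (rule indep_vars_compose2[OF Y_indep]) simp
    have sym: "distr M borel (\<lambda>\<omega>. column i (Y \<omega>) - \<mu>) = distr M borel (\<lambda>\<omega>. - (column i (Y \<omega>) - \<mu>))" for i
      using Y_symmetric[of i] by simp
    have "(\<Sum>w\<in>?SM. prob (Y -` A w \<inter> space M))
        = (\<Sum>w\<in>?SM. prob {\<omega> \<in> space M. card {j. \<phi> (weighted_mean (\<lambda>i. column i (Y \<omega>) - \<mu>) (\<lambda>_. 1))
            \<le> \<phi> (weighted_mean (\<lambda>i. column i (Y \<omega>) - \<mu>) (w j))} \<le> k})"
      by (intro sum.cong refl arg_cong[where f = prob]) (auto simp: A_def)
    also have "\<dots> \<le> (real k + 1) / (real CARD('b) + 1) * ?c"
      by (rule sum_prob_few_exceedances_le[OF ind sym phi])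
    finally show "(\<Sum>w\<in>?SM. prob (Y -` A w \<inter> space M)) \<le> (real k + 1) / (real CARD('b) + 1) * ?c" .
  qed simp
  finally show "prob G \<le> (real k + 1) / (real CARD('b) + 1)" by simp
qed

section \<open>The level of the Monte Carlo test\<close>

theorem proposition3p4:
  fixes M :: "'a measure"
    and Y :: "'a \<Rightarrow> real^'n^'k"
    and W :: "'a \<Rightarrow> real^'b^'n"
    and \<mu> :: "real^'k"
    and \<phi> :: "real^'k \<Rightarrow> real"
    and f :: "real^'n^'k \<Rightarrow> real^'b^'n \<Rightarrow> real"
    and \<delta> \<alpha>\<^sub>0 :: real
  assumes "prob_space M"
    and "CARD('n) \<ge> 2"
    and "0 < \<delta>" "\<delta> < 1" "0 < \<alpha>\<^sub>0" "\<alpha>\<^sub>0 < 1"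
    and Y_indep: "prob_space.indep_vars M (\<lambda>_. borel) (\<lambda>i \<omega>. column i (Y \<omega>)) UNIV"
    and Y_ident: "\<And>i i'. distr M borel (\<lambda>\<omega>. column i (Y \<omega>)) = distr M borel (\<lambda>\<omega>. column i' (Y \<omega>))"
    and Y_integrable: "\<And>i. integrable M (\<lambda>\<omega>. column i (Y \<omega>))"
    and Y_mean: "\<And>i. integral\<^sup>L M (\<lambda>\<omega>. column i (Y \<omega>)) = \<mu>"
    and Y_symmetric: "\<And>i. distr M borel (\<lambda>\<omega>. column i (Y \<omega>) - \<mu>) = distr M borel (\<lambda>\<omega>. \<mu> - column i (Y \<omega>))"
    and W_indep: "prob_space.indep_vars M (\<lambda>_. borel) (\<lambda>(i, j) \<omega>. W \<omega> $ i $ j) UNIV"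
    and W_rademacher: "\<And>i j. rademacher M (\<lambda>\<omega>. W \<omega> $ i $ j)"
    and YW_indep: "indep_rv M borel Y borel W"
    and f_measurable: "(\<lambda>(y, w). f y w) \<in> borel_measurable (borel \<Otimes>\<^sub>M borel)"
    and f_nonneg: "\<And>y w. (\<forall>i j. w $ i $ j \<in> {-1, 1}) \<Longrightarrow> 0 \<le> f y w"
    and phi_nonneg: "\<And>x. 0 \<le> \<phi> x"
    and "subadditive_fun \<phi>"
    and "pos_homogeneous \<phi>"
  shows "measure M {\<omega> \<in> space M. \<phi> (sample_mean (Y \<omega>) - \<mu>) >
             mc_quantile (\<alpha>\<^sub>0 * (1 - \<delta>)) \<phi> (centred (Y \<omega>)) (W \<omega>)
               + mc_gamma (W \<omega>) (\<alpha>\<^sub>0 * \<delta>) * f (Y \<omega>) (W \<omega>)}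
           \<le> alpha_tilde CARD('b) \<alpha>\<^sub>0
             + measure M {\<omega> \<in> space M. sym_max \<phi> (sample_mean (Y \<omega>) - \<mu>) > f (Y \<omega>) (W \<omega>)}
         \<and> alpha_tilde CARD('b) \<alpha>\<^sub>0 \<le> \<alpha>\<^sub>0 + 1 / (real CARD('b) + 1)"
proof -
  interpret prob_space M by fact
  note sub = \<open>subadditive_fun \<phi>\<close> and hom = \<open>pos_homogeneous \<phi>\<close>
  let ?Z = "\<lambda>\<omega>. sample_mean (Y \<omega>) - \<mu>"
  let ?E = "{\<omega> \<in> space M. \<phi> (?Z \<omega>) >
             mc_quantile (\<alpha>\<^sub>0 * (1 - \<delta>)) \<phi> (centred (Y \<omega>)) (W \<omega>)
               + mc_gamma (W \<omega>) (\<alpha>\<^sub>0 * \<delta>) * f (Y \<omega>) (W \<omega>)}"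
  let ?F = "{\<omega> \<in> space M. sym_max \<phi> (?Z \<omega>) > f (Y \<omega>) (W \<omega>)}"
  define k where "k = nat \<lfloor>real CARD('b) * \<alpha>\<^sub>0\<rfloor>"
  define G where "G = {\<omega> \<in> space M. (\<forall>i j. W \<omega> $ i $ j \<in> {- 1, 1}) \<and>
      card {j. \<phi> (?Z \<omega>) \<le> \<phi> (weighted_mean (\<lambda>i. column i (Y \<omega>) - \<mu>) (\<lambda>i. W \<omega> $ i $ j))} \<le> k}"
  have tilde: "alpha_tilde CARD('b) \<alpha>\<^sub>0 = (real k + 1) / (real CARD('b) + 1)"
    using \<open>0 < \<alpha>\<^sub>0\<close> by (simp add: alpha_tilde_def k_def)
  have phi[measurable]: "\<phi> \<in> borel_measurable borel"
    using sublinear_continuous[OF sub hom] by (rule borel_measurable_continuous_onI)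
  have G: "G \<in> events" "prob G \<le> alpha_tilde CARD('b) \<alpha>\<^sub>0"
    unfolding G_def tilde
    by (rule prob_few_resampled_exceedances_le[OF Y_indep Y_symmetric W_indep W_rademacher YW_indep phi])+
  have F: "?F \<in> events"
  proof -
    have [measurable]: "Y \<in> borel_measurable M" "W \<in> borel_measurable M"
      using YW_indep by (auto simp: indep_rv_def)
    have [measurable]: "(\<lambda>\<omega>. f (Y \<omega>) (W \<omega>)) \<in> borel_measurable M"
      using measurable_compose[OF measurable_Pair f_measurable, of Y M W] by simp
    have [measurable]: "(\<lambda>\<omega>. column i (Y \<omega>)) \<in> borel_measurable M" for i
      using Y_integrable by (rule borel_measurable_integrable)
    have [measurable]: "?Z \<in> borel_measurable M"
      unfolding sample_mean_def by measurable
    show ?thesis unfolding sym_max_def by measurable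
  qed
  have "AE \<omega> in M. \<omega> \<in> ?E \<longrightarrow> \<omega> \<in> G \<union> ?F"
    using AE_sign_matrix[OF W_rademacher]
  proof (rule AE_mp, intro AE_I2 impI)
    fix \<omega> assume signs: "\<forall>i j. W \<omega> $ i $ j \<in> {- 1, 1}" and E: "\<omega> \<in> ?E"
    show "\<omega> \<in> G \<union> ?F"
    proof (cases "sym_max \<phi> (?Z \<omega>) \<le> f (Y \<omega>) (W \<omega>)")
      case True
      have "card {j. \<phi> (?Z \<omega>) \<le> \<phi> (weighted_mean (\<lambda>i. column i (Y \<omega>) - \<mu>) (\<lambda>i. W \<omega> $ i $ j))} \<le> k"
        unfolding k_def using E f_nonneg[OF signs] True
        by (intro card_resampled_exceedances_le[OF \<open>0 < \<delta>\<close> \<open>\<delta> < 1\<close> \<open>0 < \<alpha>\<^sub>0\<close> \<open>\<alpha>\<^sub>0 < 1\<close> sub hom]) auto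
      with signs E show ?thesis by (simp add: G_def)
    next
      case False
      with E show ?thesis by simp
    qed
  qed
  then have "prob ?E \<le> prob (G \<union> ?F)"
    using G(1) F by (intro finite_measure_mono_AE) auto
  also have "\<dots> \<le> prob G + prob ?F"
    using G(1) F by (rule measure_Un_le)
  finally have "prob ?E \<le> alpha_tilde CARD('b) \<alpha>\<^sub>0 + prob ?F"
    using G(2) by simp
  moreover have "alpha_tilde CARD('b) \<alpha>\<^sub>0 \<le> \<alpha>\<^sub>0 + 1 / (real CARD('b) + 1)"
  proof -
    have "alpha_tilde CARD('b) \<alpha>\<^sub>0 \<le> (real CARD('b) * \<alpha>\<^sub>0 + 1) / (real CARD('b) + 1)"
      unfolding alpha_tilde_def by (intro divide_right_mono add_mono) auto
    also have "\<dots> \<le> ((real CARD('b) + 1) * \<alpha>\<^sub>0 + 1) / (real CARD('b) + 1)"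
      using \<open>0 < \<alpha>\<^sub>0\<close> by (intro divide_right_mono) (auto simp: algebra_simps)
    also have "\<dots> = \<alpha>\<^sub>0 + 1 / (real CARD('b) + 1)"
      by (simp add: add_divide_distrib)
    finally show ?thesis .
  qed
  ultimately show ?thesis by blast
qed

end
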